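(* Let $\mu>-1$, $q>-1$, $0<\gamma<1$, and let $w:(0,\infty)\to(0,\infty)$ be an upper $q$-power weight, i.e. $w$ is positive, finite, measurable and $x\mapsto w(x)x^{-q}$ is nondecreasing on $(0,\infty)$. Then for every $\theta\in(\gamma,1)$ and all $x>0$, $$\int_0^x e^{-\gamma t}w(t)t^{-\mu}I_\mu(t)\,dt\le M_{\mu,q,\gamma}(\theta)\,e^{-\gamma x}w(x)x^{-\mu}I_{\mu+1}(x),$$ where $$M_{\mu,q,\gamma}(\theta)=\max\left\{K_{\mu,q}\exp\left(\gamma X_{\mu,q}(\theta)\right),\ \frac{1}{\beta_{\mu,q}(\theta)(\theta-\gamma)}\right\}.$$
   Context: $I_\alpha(x)=\sum_{k=0}^{\infty}\frac{(x/2)^{2k+\alpha}}{k!\,\Gamma(k+\alpha+1)}$, $x>0$, is the modified Bessel function of the first kind. For $\mu>-1$, $q>-1$, $0<\theta<1$: $K_{\mu,q}=\max\{1,\frac{2(\mu+1)}{q+1}\}$; $X_{\mu,q}(\theta)=\frac{2(\mu+2)\theta}{1-\theta}$ if $q\ge0$, and if $-1<q<0$, $$X_{\mu,q}(\theta)=\max\left\{\frac{2(\mu+2)\theta}{1-\theta},\ \frac{(2\mu+2)\theta-q+\sqrt{\{(2\mu+2)\theta-q\}^2-4(1-\theta)q(2\mu+2)}}{2(1-\theta)}\right\};$$ $\beta_{\mu,q}(\theta)=\frac{X_{\mu,q}(\theta)}{X_{\mu,q}(\theta)+2\mu+2}$. *)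

theory Defs
  imports "HOL-Analysis.Analysis"
begin

text \<open>
  The modified Bessel function of the first kind, meant for \<open>x > 0\<close>. For \<open>\<alpha> > -1\<close> all arguments
  of Gamma below are positive and the series converges.
\<close>

definition bessel_I :: "real \<Rightarrow> real \<Rightarrow> real" where
  "bessel_I \<alpha> x =
     (\<Sum>k. (x / 2) powr (2 * real k + \<alpha>) / (fact k * Gamma (real k + \<alpha> + 1)))"

text \<open>
  A weight on \<open>(0, \<infinity>)\<close> is a total function whose values outside \<open>{0<..}\<close> are irrelevant.
  Finiteness is expressed by the type.
\<close>

definition upper_power_weight :: "real \<Rightarrow> (real \<Rightarrow> real) \<Rightarrow> bool" where
  "upper_power_weight q w \<longleftrightarrow>
     (\<forall>x>0. w x > 0) \<and>
     w \<in> borel_measurable (lebesgue_on {0<..}) \<and>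
     mono_on {0<..} (\<lambda>x. w x * x powr (- q))"

definition K_const :: "real \<Rightarrow> real \<Rightarrow> real" where
  "K_const \<mu> q = max 1 (2 * (\<mu> + 1) / (q + 1))"

definition X_const :: "real \<Rightarrow> real \<Rightarrow> real \<Rightarrow> real" where
  "X_const \<mu> q \<theta> =
     (if q \<ge> 0 then 2 * (\<mu> + 2) * \<theta> / (1 - \<theta>)
      else max (2 * (\<mu> + 2) * \<theta> / (1 - \<theta>))
             (((2 * \<mu> + 2) * \<theta> - q
               + sqrt (((2 * \<mu> + 2) * \<theta> - q)\<^sup>2 - 4 * (1 - \<theta>) * q * (2 * \<mu> + 2)))
              / (2 * (1 - \<theta>))))"

definition beta_const :: "real \<Rightarrow> real \<Rightarrow> real \<Rightarrow> real" where
  "beta_const \<mu> q \<theta> = X_const \<mu> q \<theta> / (X_const \<mu> q \<theta> + 2 * \<mu> + 2)"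

definition M_const :: "real \<Rightarrow> real \<Rightarrow> real \<Rightarrow> real \<Rightarrow> real" where
  "M_const \<mu> q \<gamma> \<theta> =
     max (K_const \<mu> q * exp (\<gamma> * X_const \<mu> q \<theta>))
         (1 / (beta_const \<mu> q \<theta> * (\<theta> - \<gamma>)))"

end

theory Submission
  imports Defs
begin

text \<open>
  Since \<open>w t * t powr (- q)\<close> is nondecreasing, \<open>w t \<le> w x * x powr (- q) * t powr q\<close> for
  \<open>0 < t \<le> x\<close>, with equality at \<open>t = x\<close>. It therefore suffices to treat the pure power weight.
  With \<open>I\<^sub>\<nu>(x) = (x/2)\<^sup>\<nu> f\<^sub>\<nu>(x)\<close> for an entire function \<open>f\<^sub>\<nu>\<close>, this means comparing
  \<open>\<integral>\<^sub>0\<^sup>x exp (- \<gamma> t) t\<^sup>q f\<^sub>\<mu>(t) dt\<close> with \<open>exp (- \<gamma> x) \<Phi>(x)\<close>, where \<open>\<Phi>(x) = x\<^bsup>q+1\<^esup> f\<^bsub>\<mu>+1\<^esub>(x) / 2\<close>.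

  The three-term recurrence \<open>f\<^sub>\<nu> = (\<nu>+1) f\<^bsub>\<nu>+1\<^esub> + (x\<^sup>2/4) f\<^bsub>\<nu>+2\<^esub>\<close> turns the derivative of \<open>\<Phi>\<close> into the
  positive combination \<open>x\<^sup>q ((q+1)/2 f\<^bsub>\<mu>+1\<^esub> + (x\<^sup>2/4) f\<^bsub>\<mu>+2\<^esub>)\<close>. Comparing coefficients with the
  recurrence for \<open>f\<^sub>\<mu>\<close> itself gives \<open>x\<^sup>q f\<^sub>\<mu> \<le> K \<Phi>'\<close> everywhere. Integrating this and bounding the
  exponential crudely by \<open>exp (- \<gamma> t) \<le> 1 \<le> exp (\<gamma> X) exp (- \<gamma> x)\<close> settles \<open>x \<le> X\<close>, and accounts
  for the first entry of the maximum defining \<open>M\<close>.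

  Beyond \<open>X\<close> the exponential has to be kept, and the derivative of \<open>exp (- \<gamma> x) \<Phi>(x)\<close> must dominate
  a multiple of the integrand. This needs \<open>I\<^sub>\<nu>\<close> and \<open>I\<^bsub>\<nu>+1\<^esub>\<close> to be comparable. The inequality
  \<open>I\<^bsub>\<nu>+1\<^esub> \<le> I\<^sub>\<nu>\<close> (lemma \<open>reduced_bessel_Soni\<close>), fed back into the recurrence, yields
  \<open>I\<^bsub>\<nu>+1\<^esub> / I\<^sub>\<nu> \<ge> x / (x + 2\<nu> + 2)\<close> (lemma \<open>reduced_bessel_ge\<close>). At order \<open>\<mu>+1\<close> this gives
  \<open>\<Phi>' \<ge> \<theta> \<Phi>\<close> as soon as \<open>x / (x + 2\<mu> + 4) \<ge> \<theta>\<close>, which is where the lower bound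
  \<open>2 (\<mu>+2) \<theta> / (1-\<theta>)\<close> for \<open>X\<close> comes from; at order \<open>\<mu>\<close> it gives \<open>\<Phi> \<ge> \<beta> x\<^sup>q f\<^sub>\<mu>\<close>. Together the
  derivative of \<open>exp (- \<gamma> x) \<Phi>(x)\<close> is at least \<open>\<beta> (\<theta>-\<gamma>) exp (- \<gamma> x) x\<^sup>q f\<^sub>\<mu>\<close>, and integrating from
  \<open>X\<close> to \<open>x\<close> accounts for the second entry of the maximum.
\<close>

section \<open>The Bessel--Clifford function\<close>

text \<open>
  Using the reciprocal \<open>rGamma\<close> of Gamma keeps the functional equation free of side conditions
  about poles.
\<close>

definition clifford_coeff :: "real \<Rightarrow> nat \<Rightarrow> real" where
  "clifford_coeff \<nu> k = rGamma (real k + \<nu> + 1) / fact k"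

definition bessel_clifford :: "real \<Rightarrow> real \<Rightarrow> real" where
  "bessel_clifford \<nu> y = (\<Sum>k. clifford_coeff \<nu> k * y ^ k)"

lemma clifford_coeff_step:
  "clifford_coeff \<nu> k = (real k + \<nu> + 1) * clifford_coeff (\<nu> + 1) k"
  using rGamma_plus1[of "real k + \<nu> + 1"] by (simp add: clifford_coeff_def algebra_simps)

lemma clifford_coeff_Suc:
  "real (Suc k) * clifford_coeff \<nu> (Suc k) = clifford_coeff (\<nu> + 1) k"
proof -
  have "real (Suc k) + \<nu> + 1 = real k + (\<nu> + 1) + 1" by simp
  hence "rGamma (real (Suc k) + \<nu> + 1) = rGamma (real k + (\<nu> + 1) + 1)" by (rule arg_cong)
  thus ?thesis by (simp only: clifford_coeff_def fact_Suc of_nat_mult) (simp del: of_nat_Suc)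
qed

lemma clifford_coeff_pos:
  assumes "\<nu> > -1"
  shows "clifford_coeff \<nu> k > 0"
proof -
  have "Gamma (real k + \<nu> + 1) > 0" by (rule Gamma_real_pos) (use assms in simp)
  thus ?thesis by (simp add: clifford_coeff_def rGamma_inverse_Gamma)
qed

lemma summable_bessel_clifford:
  assumes "\<nu> > -1"
  shows "summable (\<lambda>k. clifford_coeff \<nu> k * y ^ k)"
proof (rule summable_ratio_test)
  fix n assume n: "nat \<lceil>2 * \<bar>y\<bar> / (\<nu> + 1)\<rceil> \<le> n"
  define d where "d = clifford_coeff \<nu> (Suc n)"
  have d: "d > 0" unfolding d_def by (rule clifford_coeff_pos[OF assms])
  have eq: "clifford_coeff \<nu> n = (real n + \<nu> + 1) * (real (Suc n) * d)"
    unfolding d_def clifford_coeff_Suc by (rule clifford_coeff_step)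
  have "2 * \<bar>y\<bar> / (\<nu> + 1) \<le> real n" using n by linarith
  hence "2 * \<bar>y\<bar> \<le> real n * (\<nu> + 1)" using assms by (simp add: field_simps)
  also have "\<dots> \<le> real (Suc n) * (real n + \<nu> + 1)"
    using assms by (intro mult_mono) auto
  finally have "2 * \<bar>y\<bar> * (d * \<bar>y\<bar> ^ n) \<le> real (Suc n) * (real n + \<nu> + 1) * (d * \<bar>y\<bar> ^ n)"
    using d by (intro mult_right_mono) auto
  thus "norm (clifford_coeff \<nu> (Suc n) * y ^ Suc n) \<le> 1 / 2 * norm (clifford_coeff \<nu> n * y ^ n)"
    using d assms unfolding d_def[symmetric] eq
    by (simp add: abs_mult power_abs mult_ac)
qed simp

lemma bessel_clifford_nonneg:
  assumes "\<nu> > -1" and "y \<ge> 0"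
  shows "bessel_clifford \<nu> y \<ge> 0"
  unfolding bessel_clifford_def
  by (rule suminf_nonneg[OF summable_bessel_clifford[OF assms(1)]])
     (use clifford_coeff_pos[OF assms(1)] assms(2) in \<open>simp add: less_imp_le\<close>)

text \<open>
  Differentiation merely raises the order, because the factor \<open>k\<close> produced by \<open>y\<^sup>k\<close> cancels against
  the factorial.
\<close>

lemma has_real_derivative_bessel_clifford:
  assumes "\<nu> > -1"
  shows "(bessel_clifford \<nu> has_real_derivative bessel_clifford (\<nu> + 1) y) (at y)"
proof -
  have "diffs (clifford_coeff \<nu>) = clifford_coeff (\<nu> + 1)"
    by (rule ext) (simp only: diffs_def clifford_coeff_Suc of_nat_eq_iff)
  thus ?thesis
    using termdiffs_strong_converges_everywhere[OF summable_bessel_clifford[OF assms], of y]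
    unfolding bessel_clifford_def[abs_def] by simp
qed

text \<open>
  In the \<open>k\<close>-th coefficient, \<open>1 / \<Gamma>(k+\<nu>+1) = (k+\<nu>+1) / \<Gamma>(k+\<nu>+2)\<close>; the summand \<open>\<nu>+1\<close> of the
  numerator gives the first term and the summand \<open>k\<close>, after cancellation with the factorial and a
  shift of the index, the second.
\<close>

lemma bessel_clifford_recurrence:
  assumes "\<nu> > -1"
  shows "bessel_clifford \<nu> y
       = (\<nu> + 1) * bessel_clifford (\<nu> + 1) y + y * bessel_clifford (\<nu> + 2) y"
proof -
  note sm = summable_bessel_clifford[of "\<nu> + 1" y] summable_bessel_clifford[of "\<nu> + 2" y]
  have "(\<lambda>k. clifford_coeff (\<nu> + 1) k * y ^ k) sums bessel_clifford (\<nu> + 1) y"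
    unfolding bessel_clifford_def using sm(1) assms by (simp add: summable_sums)
  hence 1: "(\<lambda>k. (\<nu> + 1) * (clifford_coeff (\<nu> + 1) k * y ^ k)) sums
      ((\<nu> + 1) * bessel_clifford (\<nu> + 1) y)" by (rule sums_mult)
  have "(\<lambda>k. clifford_coeff (\<nu> + 2) k * y ^ k) sums bessel_clifford (\<nu> + 2) y"
    unfolding bessel_clifford_def using sm(2) assms by (simp add: summable_sums)
  hence "(\<lambda>k. y * (clifford_coeff (\<nu> + 2) k * y ^ k)) sums (y * bessel_clifford (\<nu> + 2) y)"
    by (rule sums_mult)
  also have "(\<lambda>k. y * (clifford_coeff (\<nu> + 2) k * y ^ k))
      = (\<lambda>k. real (Suc k) * clifford_coeff (\<nu> + 1) (Suc k) * y ^ Suc k)"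
    using clifford_coeff_Suc[of _ "\<nu> + 1"] by (auto simp: add.assoc)
  finally have 2: "(\<lambda>k. real k * clifford_coeff (\<nu> + 1) k * y ^ k) sums
      (y * bessel_clifford (\<nu> + 2) y)"
    by (subst (asm) sums_Suc_iff) simp
  have "(\<lambda>k. clifford_coeff \<nu> k * y ^ k) sums
      ((\<nu> + 1) * bessel_clifford (\<nu> + 1) y + y * bessel_clifford (\<nu> + 2) y)"
    using sums_add[OF 1 2] by (subst clifford_coeff_step) (simp add: algebra_simps)
  thus ?thesis unfolding bessel_clifford_def[of \<nu>] by (rule sums_unique[symmetric])
qed

text \<open>
  The entire factor of the modified Bessel function, that is \<open>(x/2)\<^bsup>-\<nu>\<^esup> I\<^sub>\<nu>(x)\<close>. It removes the
  branch point at \<open>0\<close>, so that derivatives and values at \<open>0\<close> are unproblematic.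
\<close>

definition reduced_bessel :: "real \<Rightarrow> real \<Rightarrow> real" where
  "reduced_bessel \<nu> x = bessel_clifford \<nu> (x\<^sup>2 / 4)"

lemma bessel_I_eq_reduced_bessel:
  assumes "\<nu> > -1" and "x > 0"
  shows "bessel_I \<nu> x = (x / 2) powr \<nu> * reduced_bessel \<nu> x"
proof -
  have "bessel_I \<nu> x = (\<Sum>k. (x / 2) powr \<nu> * (clifford_coeff \<nu> k * (x\<^sup>2 / 4) ^ k))"
    unfolding bessel_I_def
  proof (rule suminf_cong)
    fix k
    have "(x / 2) powr (2 * real k) = (x / 2) ^ (2 * k)"
      using assms(2) powr_realpow[of "x / 2" "2 * k"] by simp
    also have "\<dots> = (x\<^sup>2 / 4) ^ k" by (simp add: power_mult power_divide)
    finally have "(x / 2) powr (2 * real k) = (x\<^sup>2 / 4) ^ k" .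
    thus "(x / 2) powr (2 * real k + \<nu>) / (fact k * Gamma (real k + \<nu> + 1))
        = (x / 2) powr \<nu> * (clifford_coeff \<nu> k * (x\<^sup>2 / 4) ^ k)"
      by (simp only: powr_add clifford_coeff_def rGamma_inverse_Gamma)
         (simp only: divide_inverse inverse_mult_distrib mult_ac)
  qed
  also have "\<dots> = (x / 2) powr \<nu> * reduced_bessel \<nu> x"
    unfolding reduced_bessel_def bessel_clifford_def
    by (rule suminf_mult[OF summable_bessel_clifford[OF assms(1)]])
  finally show ?thesis .
qed

lemma reduced_bessel_nonneg: "\<nu> > -1 \<Longrightarrow> reduced_bessel \<nu> x \<ge> 0"
  by (simp add: reduced_bessel_def bessel_clifford_nonneg)

lemma reduced_bessel_recurrence:
  "\<nu> > -1 \<Longrightarrow> reduced_bessel \<nu> x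
     = (\<nu> + 1) * reduced_bessel (\<nu> + 1) x + x\<^sup>2 / 4 * reduced_bessel (\<nu> + 2) x"
  unfolding reduced_bessel_def by (rule bessel_clifford_recurrence)

lemma has_real_derivative_reduced_bessel:
  assumes "\<nu> > -1"
  shows "(reduced_bessel \<nu> has_real_derivative x / 2 * reduced_bessel (\<nu> + 1) x) (at x within A)"
proof -
  have "((\<lambda>x. bessel_clifford \<nu> (x\<^sup>2 / 4)) has_real_derivative
      bessel_clifford (\<nu> + 1) (x\<^sup>2 / 4) * (x / 2)) (at x within A)"
    by (rule DERIV_chain2[OF has_real_derivative_bessel_clifford[OF assms]])
       (auto intro!: derivative_eq_intros)
  thus ?thesis by (simp add: reduced_bessel_def[abs_def] mult.commute)
qed

lemma continuous_on_reduced_bessel: "\<nu> > -1 \<Longrightarrow> continuous_on A (reduced_bessel \<nu>)"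
  by (rule DERIV_continuous_on[OF has_real_derivative_reduced_bessel])

section \<open>Ratios of consecutive orders\<close>

text \<open>
  In terms of Bessel functions this is \<open>I\<^bsub>\<nu>+1\<^esub>(x) \<le> I\<^sub>\<nu>(x)\<close>, an inequality of Soni. For the difference
  \<open>\<delta>\<close> of the two sides, the recurrence gives \<open>\<delta>' = - \<delta> + (\<nu> + 1/2) f\<^bsub>\<nu>+1\<^esub>\<close>. Hence \<open>exp x * \<delta> x\<close> is
  nondecreasing for \<open>\<nu> \<ge> -1/2\<close>, and it is nonnegative at \<open>0\<close>.
\<close>

lemma reduced_bessel_Soni:
  assumes "\<nu> \<ge> -1/2" and "x \<ge> 0"
  shows "x / 2 * reduced_bessel (\<nu> + 1) x \<le> reduced_bessel \<nu> x"
proof -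
  define D where "D x = exp x * (reduced_bessel \<nu> x - x / 2 * reduced_bessel (\<nu> + 1) x)" for x
  have \<nu>: "\<nu> > -1" "\<nu> + 1 > -1" using assms by auto
  have "D 0 \<le> D x"
  proof (rule DERIV_nonneg_imp_nondecreasing[OF assms(2)])
    fix t :: real
    have "(reduced_bessel (\<nu> + 1) has_real_derivative t / 2 * reduced_bessel (\<nu> + 2) t) (at t)"
      using has_real_derivative_reduced_bessel[OF \<nu>(2), of t] by (simp add: add.assoc)
    hence "(D has_real_derivative exp t * (reduced_bessel \<nu> t - t / 2 * reduced_bessel (\<nu> + 1) t)
        + exp t * (t / 2 * reduced_bessel (\<nu> + 1) t - (1 / 2 * reduced_bessel (\<nu> + 1) t
          + t / 2 * (t / 2 * reduced_bessel (\<nu> + 2) t)))) (at t)"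
      unfolding D_def[abs_def]
      by (auto intro!: derivative_eq_intros has_real_derivative_reduced_bessel \<nu>
          simp: field_simps)
    moreover have "exp t * (reduced_bessel \<nu> t - t / 2 * reduced_bessel (\<nu> + 1) t)
        + exp t * (t / 2 * reduced_bessel (\<nu> + 1) t - (1 / 2 * reduced_bessel (\<nu> + 1) t
          + t / 2 * (t / 2 * reduced_bessel (\<nu> + 2) t)))
        = exp t * ((\<nu> + 1 / 2) * reduced_bessel (\<nu> + 1) t)"
      using reduced_bessel_recurrence[OF \<nu>(1), of t] by (simp add: algebra_simps power2_eq_square)
    ultimately have "(D has_real_derivative
        exp t * ((\<nu> + 1 / 2) * reduced_bessel (\<nu> + 1) t)) (at t)"
      by simp
    moreover have "exp t * ((\<nu> + 1 / 2) * reduced_bessel (\<nu> + 1) t) \<ge> 0"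
      using assms reduced_bessel_nonneg[OF \<nu>(2), of t] by simp
    ultimately show "\<exists>y. (D has_real_derivative y) (at t) \<and> 0 \<le> y" by blast
  qed
  moreover have "D 0 \<ge> 0" using reduced_bessel_nonneg[OF \<nu>(1)] by (simp add: D_def)
  ultimately have "D x \<ge> 0" by simp
  thus ?thesis by (simp add: D_def zero_le_mult_iff)
qed

text \<open>
  This is the bound \<open>I\<^bsub>\<nu>+1\<^esub>(x) / I\<^sub>\<nu>(x) \<ge> x / (x + 2\<nu> + 2)\<close>: the term of order \<open>\<nu>+2\<close> in the recurrence
  is absorbed by the preceding inequality at order \<open>\<nu>+1\<close>. The shift by one makes the range
  \<open>\<nu> > -1\<close> accessible although that inequality starts only at \<open>-1/2\<close>.
\<close>

lemma reduced_bessel_ge: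
  assumes "\<nu> > -1" and "x \<ge> 0"
  shows "reduced_bessel \<nu> x \<le> (\<nu> + 1 + x / 2) * reduced_bessel (\<nu> + 1) x"
proof -
  have "x / 2 * reduced_bessel (\<nu> + 2) x \<le> reduced_bessel (\<nu> + 1) x"
    using reduced_bessel_Soni[of "\<nu> + 1" x] assms by (simp add: add.assoc)
  from mult_left_mono[OF this, of "x / 2"] show ?thesis
    using reduced_bessel_recurrence[OF assms(1), of x] assms(2)
    by (simp add: algebra_simps power2_eq_square)
qed

section \<open>Differential inequalities for the majorant\<close>

text \<open>
  Up to the constant \<open>2\<^sup>\<mu>\<close> this is \<open>x\<^bsup>q-\<mu>\<^esup> I\<^bsub>\<mu>+1\<^esub>(x)\<close>, the right-hand side for the weight \<open>x\<^sup>q\<close> without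
  its exponential factor. The exponent \<open>q+1\<close> is positive, so it vanishes at \<open>0\<close>.
\<close>

definition majorant :: "real \<Rightarrow> real \<Rightarrow> real \<Rightarrow> real" where
  "majorant \<mu> q x = x powr (q + 1) / 2 * reduced_bessel (\<mu> + 1) x"

text \<open>
  The derivative of the majorant divided by \<open>x powr q\<close>.
\<close>

definition majorant_slope :: "real \<Rightarrow> real \<Rightarrow> real \<Rightarrow> real" where
  "majorant_slope \<mu> q x =
     (q + 1) / 2 * reduced_bessel (\<mu> + 1) x + x\<^sup>2 / 4 * reduced_bessel (\<mu> + 2) x"

lemma has_real_derivative_majorant:
  assumes "\<mu> > -1" and "x > 0"
  shows "(majorant \<mu> q has_real_derivative x powr q * majorant_slope \<mu> q x) (at x)"
proof -
  have "x powr (q + 1) = x * x powr q" using assms by (simp add: powr_add)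
  thus ?thesis
    unfolding majorant_def[abs_def] majorant_slope_def using assms
    by (auto intro!: derivative_eq_intros has_real_derivative_reduced_bessel
        simp: add.assoc algebra_simps power2_eq_square)
qed

lemma continuous_on_majorant:
  assumes "\<mu> > -1" and "q > -1"
  shows "continuous_on {0..b} (majorant \<mu> q)"
  unfolding majorant_def[abs_def] using assms
  by (intro continuous_intros continuous_on_reduced_bessel continuous_on_powr') auto

lemma majorant_nonneg: "\<mu> > -1 \<Longrightarrow> majorant \<mu> q x \<ge> 0"
  by (simp add: majorant_def reduced_bessel_nonneg)

text \<open>
  Both sides are combinations of \<open>f\<^bsub>\<mu>+1\<^esub>\<close> and \<open>(x\<^sup>2/4) f\<^bsub>\<mu>+2\<^esub>\<close>. Comparing the coefficients of the first
  requires \<open>\<mu> + 1 \<le> K (q+1) / 2\<close> and of the second \<open>1 \<le> K\<close>; the constant \<open>K\<close> is the smallest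
  number satisfying both.
\<close>

lemma reduced_bessel_le_majorant_slope:
  assumes "\<mu> > -1" and "q > -1"
  shows "reduced_bessel \<mu> x \<le> K_const \<mu> q * majorant_slope \<mu> q x"
proof -
  define K where "K = K_const \<mu> q"
  have K1: "K \<ge> 1" by (simp add: K_def K_const_def)
  have "2 * (\<mu> + 1) / (q + 1) \<le> K" by (simp add: K_def K_const_def)
  hence K2: "\<mu> + 1 \<le> K * ((q + 1) / 2)" using assms by (simp add: field_simps)
  have "reduced_bessel \<mu> x
      = (\<mu> + 1) * reduced_bessel (\<mu> + 1) x + x\<^sup>2 / 4 * reduced_bessel (\<mu> + 2) x"
    by (rule reduced_bessel_recurrence[OF assms(1)])
  also have "\<dots> \<le> K * ((q + 1) / 2) * reduced_bessel (\<mu> + 1) x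
      + K * (x\<^sup>2 / 4 * reduced_bessel (\<mu> + 2) x)"
  proof (rule add_mono)
    show "(\<mu> + 1) * reduced_bessel (\<mu> + 1) x \<le> K * ((q + 1) / 2) * reduced_bessel (\<mu> + 1) x"
      using K2 by (rule mult_right_mono) (use assms in \<open>simp add: reduced_bessel_nonneg\<close>)
    have "1 * (x\<^sup>2 / 4 * reduced_bessel (\<mu> + 2) x) \<le> K * (x\<^sup>2 / 4 * reduced_bessel (\<mu> + 2) x)"
      using K1 by (rule mult_right_mono) (use assms in \<open>simp add: reduced_bessel_nonneg\<close>)
    thus "x\<^sup>2 / 4 * reduced_bessel (\<mu> + 2) x \<le> K * (x\<^sup>2 / 4 * reduced_bessel (\<mu> + 2) x)" by simp
  qed
  finally show ?thesis by (simp add: majorant_slope_def K_def algebra_simps)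
qed

text \<open>
  Logarithmic growth of the majorant at rate \<open>\<theta>\<close>. The order \<open>\<mu>+2\<close> part of the slope is already
  enough, since \<open>f\<^bsub>\<mu>+1\<^esub> \<le> (\<mu> + 2 + x/2) f\<^bsub>\<mu>+2\<^esub>\<close> and the hypothesis on \<open>x\<close> says
  \<open>\<theta> (x + 2\<mu> + 4) \<le> x\<close>.
\<close>

lemma majorant_slope_ge:
  assumes "\<mu> > -1" and "q > -1" and "0 < \<theta>" and "x > 0"
    and x: "2 * (\<mu> + 2) * \<theta> \<le> (1 - \<theta>) * x"
  shows "\<theta> * (x / 2 * reduced_bessel (\<mu> + 1) x) \<le> majorant_slope \<mu> q x"
proof -
  have nn: "reduced_bessel (\<mu> + 1) x \<ge> 0" "reduced_bessel (\<mu> + 2) x \<ge> 0"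
    using assms by (simp_all add: reduced_bessel_nonneg)
  have "\<theta> * (x / 2 * reduced_bessel (\<mu> + 1) x)
      \<le> \<theta> * (x / 2 * ((\<mu> + 2 + x / 2) * reduced_bessel (\<mu> + 2) x))"
    using reduced_bessel_ge[of "\<mu> + 1" x] assms
    by (intro mult_left_mono) (simp_all add: add.assoc)
  also have "\<dots> = (\<theta> * (2 * \<mu> + 4 + x)) * (x / 4 * reduced_bessel (\<mu> + 2) x)"
    by (simp add: algebra_simps)
  also have "\<dots> \<le> x * (x / 4 * reduced_bessel (\<mu> + 2) x)"
    using x nn assms by (intro mult_right_mono) (simp_all add: algebra_simps)
  also have "\<dots> \<le> majorant_slope \<mu> q x"
    using nn assms by (simp add: majorant_slope_def power2_eq_square)
  finally show ?thesis .
qed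

text \<open>
  The factor \<open>exp (- \<gamma> x)\<close> costs a rate \<open>\<gamma>\<close> out of the growth rate \<open>\<theta>\<close>. What remains,
  \<open>\<theta> - \<gamma>\<close> times the majorant, is converted into \<open>f\<^sub>\<mu>\<close> by the ratio bound at order \<open>\<mu>\<close>, where
  \<open>x / (x + 2\<mu> + 2)\<close> increases with \<open>x\<close> and so is at least its value at \<open>X\<close>.
\<close>

lemma damped_majorant_slope_ge:
  assumes "\<mu> > -1" and "q > -1" and "\<gamma> < \<theta>" and "0 < \<theta>" and "0 < X" and "X \<le> x"
    and X: "2 * (\<mu> + 2) * \<theta> \<le> (1 - \<theta>) * X" and "\<theta> < 1"
  shows "X / (X + 2 * \<mu> + 2) * (\<theta> - \<gamma>) * reduced_bessel \<mu> x
       \<le> majorant_slope \<mu> q x - \<gamma> * (x / 2 * reduced_bessel (\<mu> + 1) x)"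
proof -
  define s where "s = \<mu> + 1"
  have s: "s > 0" using assms by (simp add: s_def)
  have nn: "reduced_bessel (\<mu> + 1) x \<ge> 0"
    using assms by (simp add: reduced_bessel_nonneg)
  have \<beta>: "X / (X + 2 * s) * (s + x / 2) \<le> x / 2"
  proof -
    have "s * X \<le> s * x" using s assms by simp
    thus ?thesis using s assms by (simp add: field_simps)
  qed
  have "X / (X + 2 * s) * reduced_bessel \<mu> x
      \<le> X / (X + 2 * s) * ((s + x / 2) * reduced_bessel (\<mu> + 1) x)"
    using reduced_bessel_ge[of \<mu> x] assms s by (intro mult_left_mono) (simp_all add: s_def)
  also have "\<dots> \<le> x / 2 * reduced_bessel (\<mu> + 1) x"
    using mult_right_mono[OF \<beta> nn] by (simp add: mult.assoc)
  finally have "(\<theta> - \<gamma>) * (X / (X + 2 * s) * reduced_bessel \<mu> x)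
      \<le> (\<theta> - \<gamma>) * (x / 2 * reduced_bessel (\<mu> + 1) x)"
    using assms by (intro mult_left_mono) simp_all
  also have "\<dots> \<le> majorant_slope \<mu> q x - \<gamma> * (x / 2 * reduced_bessel (\<mu> + 1) x)"
  proof -
    have "(1 - \<theta>) * X \<le> (1 - \<theta>) * x" using assms by (intro mult_left_mono) auto
    with X have "2 * (\<mu> + 2) * \<theta> \<le> (1 - \<theta>) * x" by simp
    thus ?thesis
      using majorant_slope_ge[of \<mu> q \<theta> x] assms by (simp add: left_diff_distrib)
  qed
  finally show ?thesis by (simp add: s_def algebra_simps)
qed

section \<open>From differential inequalities to integral inequalities\<close>

text \<open>
  The fundamental theorem of calculus as an upper bound. Only continuity is asked at the left end
  point, as \<open>t powr q\<close> is singular at \<open>0\<close> for negative \<open>q\<close>. Keeping the initial value \<open>\<Phi> a\<close> on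
  the left makes the bounds on adjacent intervals chain without subtraction in \<open>ennreal\<close>.
\<close>

lemma nn_integral_le_increment:
  fixes \<Phi> \<Phi>' \<phi> :: "real \<Rightarrow> real"
  assumes "a \<le> b" and "continuous_on {a..b} \<Phi>" and start: "0 \<le> \<Phi> a"
    and deriv: "\<And>t. a < t \<Longrightarrow> t \<le> b \<Longrightarrow> (\<Phi> has_real_derivative \<Phi>' t) (at t)"
    and nonneg: "\<And>t. a < t \<Longrightarrow> t \<le> b \<Longrightarrow> 0 \<le> \<phi> t"
    and le: "\<And>t. a < t \<Longrightarrow> t \<le> b \<Longrightarrow> \<phi> t \<le> \<Phi>' t"
  shows "ennreal (\<Phi> a) + (\<integral>\<^sup>+ t\<in>{a<..b}. ennreal (\<phi> t) \<partial>lebesgue) \<le> ennreal (\<Phi> b)"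
proof -
  define g where "g t = (if t = a then 0 else \<Phi>' t)" for t
  \<comment> \<open>Nothing is known about \<open>\<Phi>' a\<close>; the value \<open>0\<close> keeps the integrand nonnegative there.\<close>
  have int: "(g has_integral (\<Phi> b - \<Phi> a)) {a..b}"
    by (rule fundamental_theorem_of_calculus_interior[OF assms(1,2)])
       (use deriv in \<open>auto simp: g_def has_real_derivative_iff_has_vector_derivative\<close>)
  have g: "0 \<le> g t" if "t \<in> {a..b}" for t
    using that nonneg[of t] le[of t] by (auto simp: g_def)
  have incr: "0 \<le> \<Phi> b - \<Phi> a" by (rule has_integral_nonneg[OF int g])
  have "(\<integral>\<^sup>+ t\<in>{a..b}. ennreal (g t) \<partial>lborel) = ennreal (\<Phi> b - \<Phi> a)"
    by (rule nn_integral_has_integral_lebesgue'[OF g int])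
  moreover have "(\<integral>\<^sup>+ t\<in>{a<..b}. ennreal (\<phi> t) \<partial>lebesgue)
      \<le> (\<integral>\<^sup>+ t\<in>{a..b}. ennreal (g t) \<partial>lebesgue)"
    by (intro nn_integral_mono) (auto simp: indicator_def g_def intro!: ennreal_leI le)
  ultimately have "(\<integral>\<^sup>+ t\<in>{a<..b}. ennreal (\<phi> t) \<partial>lebesgue) \<le> ennreal (\<Phi> b - \<Phi> a)"
    by (simp add: nn_integral_completion)
  hence "ennreal (\<Phi> a) + (\<integral>\<^sup>+ t\<in>{a<..b}. ennreal (\<phi> t) \<partial>lebesgue)
      \<le> ennreal (\<Phi> a) + ennreal (\<Phi> b - \<Phi> a)" by (rule add_left_mono)
  also have "\<dots> = ennreal (\<Phi> b)" using start incr by (simp flip: ennreal_plus)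
  finally show ?thesis .
qed

lemma nn_integral_reduced_bessel_le_K:
  assumes "\<mu> > -1" and "q > -1" and "\<gamma> > 0" and "x \<ge> 0"
  shows "(\<integral>\<^sup>+ t\<in>{0<..x}. ennreal (exp (- \<gamma> * t) * (t powr q * reduced_bessel \<mu> t)) \<partial>lebesgue)
       \<le> ennreal (K_const \<mu> q * majorant \<mu> q x)"
proof -
  have "ennreal (K_const \<mu> q * majorant \<mu> q 0) +
      (\<integral>\<^sup>+ t\<in>{0<..x}. ennreal (exp (- \<gamma> * t) * (t powr q * reduced_bessel \<mu> t)) \<partial>lebesgue)
      \<le> ennreal (K_const \<mu> q * majorant \<mu> q x)"
  proof (rule nn_integral_le_increment[OF assms(4)])
    show "continuous_on {0..x} (\<lambda>t. K_const \<mu> q * majorant \<mu> q t)"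
      using assms by (intro continuous_intros continuous_on_majorant)
    show "0 \<le> K_const \<mu> q * majorant \<mu> q 0" by (simp add: majorant_def)
    fix t :: real assume t: "0 < t"
    show "((\<lambda>t. K_const \<mu> q * majorant \<mu> q t) has_real_derivative
        K_const \<mu> q * (t powr q * majorant_slope \<mu> q t)) (at t)"
      using assms t by (intro DERIV_cmult has_real_derivative_majorant)
    have nn: "0 \<le> t powr q * reduced_bessel \<mu> t"
      using assms by (simp add: reduced_bessel_nonneg)
    thus "0 \<le> exp (- \<gamma> * t) * (t powr q * reduced_bessel \<mu> t)" by simp
    have "exp (- \<gamma> * t) * (t powr q * reduced_bessel \<mu> t) \<le> 1 * (t powr q * reduced_bessel \<mu> t)"
      using nn assms t by (intro mult_right_mono) auto
    also have "\<dots> \<le> t powr q * (K_const \<mu> q * majorant_slope \<mu> q t)"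
      using reduced_bessel_le_majorant_slope[OF assms(1,2), of t] by (simp add: mult_left_mono)
    finally show "exp (- \<gamma> * t) * (t powr q * reduced_bessel \<mu> t)
        \<le> K_const \<mu> q * (t powr q * majorant_slope \<mu> q t)" by (simp add: mult_ac)
  qed
  thus ?thesis by (simp add: majorant_def)
qed

lemma nn_integral_reduced_bessel_le_tail:
  assumes "\<mu> > -1" and "q > -1" and "\<gamma> < \<theta>" and "0 < \<theta>" and "\<theta> < 1" and "0 < X" and "X \<le> x"
    and X: "2 * (\<mu> + 2) * \<theta> \<le> (1 - \<theta>) * X"
    and M: "1 / (X / (X + 2 * \<mu> + 2) * (\<theta> - \<gamma>)) \<le> M"
  shows "ennreal (M * (exp (- \<gamma> * X) * majorant \<mu> q X)) +
      (\<integral>\<^sup>+ t\<in>{X<..x}. ennreal (exp (- \<gamma> * t) * (t powr q * reduced_bessel \<mu> t)) \<partial>lebesgue)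
      \<le> ennreal (M * (exp (- \<gamma> * x) * majorant \<mu> q x))"
proof (rule nn_integral_le_increment[OF assms(7)])
  define c where "c = X / (X + 2 * \<mu> + 2) * (\<theta> - \<gamma>)"
  have c: "c > 0" using assms by (simp add: c_def)
  have M1: "1 \<le> M * c" using M c unfolding c_def[symmetric] by (simp add: field_simps)
  have "M > 0" using M1 c by (smt (verit) mult_nonpos_nonneg)
  show "continuous_on {X..x} (\<lambda>t. M * (exp (- \<gamma> * t) * majorant \<mu> q t))"
    using assms by (intro continuous_intros continuous_on_subset[OF continuous_on_majorant[of \<mu> q x]]) auto
  show "0 \<le> M * (exp (- \<gamma> * X) * majorant \<mu> q X)"
    using \<open>M > 0\<close> majorant_nonneg[OF assms(1)] by simp
  fix t assume t: "X < t"
  show "((\<lambda>t. M * (exp (- \<gamma> * t) * majorant \<mu> q t)) has_real_derivative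
      M * (exp (- \<gamma> * t) * (t powr q * (majorant_slope \<mu> q t
        - \<gamma> * (t / 2 * reduced_bessel (\<mu> + 1) t))))) (at t)"
  proof -
    have "((\<lambda>t. M * (exp (- \<gamma> * t) * majorant \<mu> q t)) has_real_derivative
        M * (exp (- \<gamma> * t) * (t powr q * majorant_slope \<mu> q t)
          - \<gamma> * exp (- \<gamma> * t) * majorant \<mu> q t)) (at t)"
      using assms t by (auto intro!: derivative_eq_intros has_real_derivative_majorant)
    moreover have "majorant \<mu> q t = t powr q * (t / 2 * reduced_bessel (\<mu> + 1) t)"
      using assms t by (simp add: majorant_def powr_add)
    ultimately show ?thesis by (simp add: algebra_simps)
  qed
  have nn: "reduced_bessel \<mu> t \<ge> 0" using assms by (simp add: reduced_bessel_nonneg)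
  thus "0 \<le> exp (- \<gamma> * t) * (t powr q * reduced_bessel \<mu> t)" by simp
  have "reduced_bessel \<mu> t \<le> M * (c * reduced_bessel \<mu> t)"
    using mult_right_mono[OF M1 nn] by (simp add: mult.assoc)
  also have "\<dots> \<le> M * (majorant_slope \<mu> q t - \<gamma> * (t / 2 * reduced_bessel (\<mu> + 1) t))"
    using damped_majorant_slope_ge[of \<mu> q \<gamma> \<theta> X t] assms t \<open>M > 0\<close>
    by (intro mult_left_mono) (simp_all add: c_def)
  finally have "exp (- \<gamma> * t) * t powr q * reduced_bessel \<mu> t \<le> exp (- \<gamma> * t) * t powr q *
      (M * (majorant_slope \<mu> q t - \<gamma> * (t / 2 * reduced_bessel (\<mu> + 1) t)))"
    by (rule mult_left_mono) simp
  thus "exp (- \<gamma> * t) * (t powr q * reduced_bessel \<mu> t) \<le> M * (exp (- \<gamma> * t) * (t powr q *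
      (majorant_slope \<mu> q t - \<gamma> * (t / 2 * reduced_bessel (\<mu> + 1) t))))"
    by (simp only: mult_ac)
qed

lemma measurable_bessel_integrand:
  assumes "\<mu> > -1"
  shows "(\<lambda>t. exp (- \<gamma> * t) * (t powr q * reduced_bessel \<mu> t)) \<in> borel_measurable lebesgue"
proof -
  have [measurable]: "reduced_bessel \<mu> \<in> borel_measurable borel"
    by (rule borel_measurable_continuous_onI[OF continuous_on_reduced_bessel[OF assms]])
  have "(\<lambda>t. exp (- \<gamma> * t) * (t powr q * reduced_bessel \<mu> t)) \<in> borel_measurable lborel"
    by measurable
  thus ?thesis by (rule measurable_completion)
qed

text \<open>
  Up to \<open>X\<close> the exponential varies by a factor of at most \<open>exp (\<gamma> X)\<close>, so the bound with \<open>K\<close>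
  suffices. For larger \<open>x\<close> that bound, taken at \<open>X\<close>, is the initial value from which the
  bound on the tail continues.
\<close>

lemma nn_integral_reduced_bessel_le_M:
  assumes "\<mu> > -1" and "q > -1" and "0 < \<gamma>" and "\<gamma> < \<theta>" and "\<theta> < 1" and "x > 0"
  shows "(\<integral>\<^sup>+ t\<in>{0<..x}. ennreal (exp (- \<gamma> * t) * (t powr q * reduced_bessel \<mu> t)) \<partial>lebesgue)
       \<le> ennreal (M_const \<mu> q \<gamma> \<theta> * (exp (- \<gamma> * x) * majorant \<mu> q x))"
proof -
  define X where "X = X_const \<mu> q \<theta>"
  define M where "M = M_const \<mu> q \<gamma> \<theta>"
  let ?\<phi> = "\<lambda>t. ennreal (exp (- \<gamma> * t) * (t powr q * reduced_bessel \<mu> t))"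
  have "2 * (\<mu> + 2) * \<theta> / (1 - \<theta>) \<le> X" by (simp add: X_def X_const_def)
  moreover have "0 < 2 * (\<mu> + 2) * \<theta> / (1 - \<theta>)" using assms by simp
  ultimately have X: "0 < X" "2 * (\<mu> + 2) * \<theta> \<le> (1 - \<theta>) * X"
    using assms by (linarith, simp add: field_simps)
  have MK: "K_const \<mu> q * exp (\<gamma> * X) \<le> M" by (simp add: M_def M_const_def X_def)
  have head: "(\<integral>\<^sup>+ t\<in>{0<..y}. ?\<phi> t \<partial>lebesgue)
      \<le> ennreal (M * (exp (- \<gamma> * y) * majorant \<mu> q y))" if y: "0 < y" "y \<le> X" for y
  proof -
    have K: "0 \<le> K_const \<mu> q" by (simp add: K_const_def max_def)
    have "1 \<le> exp (\<gamma> * X) * exp (- \<gamma> * y)"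
      using y assms unfolding exp_add[symmetric] by simp
    hence "K_const \<mu> q * 1 \<le> K_const \<mu> q * (exp (\<gamma> * X) * exp (- \<gamma> * y))"
      using K by (rule mult_left_mono)
    also have "\<dots> = K_const \<mu> q * exp (\<gamma> * X) * exp (- \<gamma> * y)" by simp
    also have "\<dots> \<le> M * exp (- \<gamma> * y)" using MK by (rule mult_right_mono) simp
    finally have "K_const \<mu> q * majorant \<mu> q y \<le> M * exp (- \<gamma> * y) * majorant \<mu> q y"
      using majorant_nonneg[OF assms(1)] by (simp add: mult_right_mono)
    with nn_integral_reduced_bessel_le_K[of \<mu> q \<gamma> y] assms y show ?thesis
      by (force intro: order_trans ennreal_leI simp: mult.assoc)
  qed
  show ?thesis
  proof (cases "x \<le> X")
    case True
    thus ?thesis using head[of x] assms by (simp add: M_def)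
  next
    case False
    let ?B = "\<lambda>y. M * (exp (- \<gamma> * y) * majorant \<mu> q y)"
    have M: "1 / (X / (X + 2 * \<mu> + 2) * (\<theta> - \<gamma>)) \<le> M"
      by (simp add: M_def M_const_def X_def beta_const_def)
    have tail: "ennreal (?B X) + (\<integral>\<^sup>+ t\<in>{X<..x}. ?\<phi> t \<partial>lebesgue) \<le> ennreal (?B x)"
      by (rule nn_integral_reduced_bessel_le_tail[where \<theta> = \<theta>]) (use assms X M False in auto)
    have meas: "(\<lambda>t. ?\<phi> t * indicator {a<..b} t) \<in> borel_measurable lebesgue" for a b
      using measurable_bessel_integrand[OF assms(1)]
      by (intro borel_measurable_times_ennreal borel_measurable_indicator
          measurable_compose[OF _ measurable_ennreal]) auto
    have "(\<integral>\<^sup>+ t\<in>{0<..x}. ?\<phi> t \<partial>lebesgue)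
        = (\<integral>\<^sup>+ t. ?\<phi> t * indicator {0<..X} t + ?\<phi> t * indicator {X<..x} t \<partial>lebesgue)"
      using False X by (intro nn_integral_cong) (auto simp: indicator_def)
    also have "\<dots> = (\<integral>\<^sup>+ t\<in>{0<..X}. ?\<phi> t \<partial>lebesgue) + (\<integral>\<^sup>+ t\<in>{X<..x}. ?\<phi> t \<partial>lebesgue)"
      by (rule nn_integral_add[OF meas meas])
    also have "\<dots> \<le> ennreal (?B X) + (\<integral>\<^sup>+ t\<in>{X<..x}. ?\<phi> t \<partial>lebesgue)"
      using head[of X] X by (intro add_right_mono) simp
    also note tail
    finally show ?thesis by (simp add: M_def)
  qed
qed

section \<open>General upper power weights\<close>

theorem theorem3p3:
  fixes \<mu> q \<gamma> \<theta> x :: real and w :: "real \<Rightarrow> real"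
  assumes "\<mu> > -1" and "q > -1" and "0 < \<gamma>" and "\<gamma> < 1"
    and "upper_power_weight q w"
    and "\<gamma> < \<theta>" and "\<theta> < 1" and "x > 0"
  shows "(\<integral>\<^sup>+ t\<in>{0<..x}. ennreal (exp (- \<gamma> * t) * w t * t powr (- \<mu>) * bessel_I \<mu> t) \<partial>lebesgue)
       \<le> ennreal (M_const \<mu> q \<gamma> \<theta> * (exp (- \<gamma> * x) * w x * x powr (- \<mu>) * bessel_I (\<mu> + 1) x))"
proof -
  define C where "C = w x * x powr (- q) * 2 powr (- \<mu>)"
  let ?\<phi> = "\<lambda>t. exp (- \<gamma> * t) * (t powr q * reduced_bessel \<mu> t)"
  have w: "w y > 0" if "y > 0" for y using assms(5) that by (auto simp: upper_power_weight_def)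
  have C: "C \<ge> 0" using w[OF assms(8)] by (simp add: C_def)
  \<comment> \<open>The powers of \<open>t\<close> cancel, leaving the entire factor.\<close>
  have I: "t powr (- \<mu>) * bessel_I \<mu> t = 2 powr (- \<mu>) * reduced_bessel \<mu> t" if "t > 0" for t
    using that assms(1)
    by (simp add: bessel_I_eq_reduced_bessel powr_divide powr_minus field_simps)
  have pointwise: "exp (- \<gamma> * t) * w t * t powr (- \<mu>) * bessel_I \<mu> t \<le> C * ?\<phi> t"
    if t: "0 < t" "t \<le> x" for t
  proof -
    have "w t * t powr (- q) \<le> w x * x powr (- q)"
      using assms(5) t by (auto simp: upper_power_weight_def mono_on_def)
    hence "w t \<le> w x * x powr (- q) * t powr q"
      using t by (simp add: powr_minus field_simps)
    hence "w t * (exp (- \<gamma> * t) * (2 powr (- \<mu>) * reduced_bessel \<mu> t))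
        \<le> w x * x powr (- q) * t powr q * (exp (- \<gamma> * t) * (2 powr (- \<mu>) * reduced_bessel \<mu> t))"
      by (rule mult_right_mono) (use assms(1) in \<open>simp add: reduced_bessel_nonneg\<close>)
    hence "exp (- \<gamma> * t) * w t * (2 powr (- \<mu>) * reduced_bessel \<mu> t) \<le> C * ?\<phi> t"
      by (simp only: C_def mult_ac)
    thus ?thesis by (simp only: I[OF t(1), symmetric] mult.assoc)
  qed
  have meas: "(\<lambda>t. ennreal (?\<phi> t) * indicator {0<..x} t) \<in> borel_measurable lebesgue"
    using measurable_bessel_integrand[OF assms(1)]
    by (intro borel_measurable_times_ennreal borel_measurable_indicator
          measurable_compose[OF _ measurable_ennreal]) auto
  have "(\<integral>\<^sup>+ t\<in>{0<..x}. ennreal (exp (- \<gamma> * t) * w t * t powr (- \<mu>) * bessel_I \<mu> t) \<partial>lebesgue)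
      \<le> (\<integral>\<^sup>+ t. ennreal C * (ennreal (?\<phi> t) * indicator {0<..x} t) \<partial>lebesgue)"
    using C pointwise
    by (intro nn_integral_mono) (auto simp: indicator_def ennreal_mult'[symmetric] intro!: ennreal_leI)
  also have "\<dots> = ennreal C * (\<integral>\<^sup>+ t\<in>{0<..x}. ennreal (?\<phi> t) \<partial>lebesgue)"
    by (rule nn_integral_cmult[OF meas])
  also have "\<dots> \<le> ennreal C * ennreal (M_const \<mu> q \<gamma> \<theta> * (exp (- \<gamma> * x) * majorant \<mu> q x))"
    using assms by (intro mult_left_mono nn_integral_reduced_bessel_le_M) auto
  also have "\<dots> = ennreal (C * (M_const \<mu> q \<gamma> \<theta> * (exp (- \<gamma> * x) * majorant \<mu> q x)))"
    using C by (simp add: ennreal_mult')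
  also have "C * (M_const \<mu> q \<gamma> \<theta> * (exp (- \<gamma> * x) * majorant \<mu> q x))
      = M_const \<mu> q \<gamma> \<theta> * (exp (- \<gamma> * x) * w x * x powr (- \<mu>) * bessel_I (\<mu> + 1) x)"
    using assms(1,8)
    by (simp add: C_def majorant_def bessel_I_eq_reduced_bessel powr_divide powr_minus powr_add
        field_simps)
  finally show ?thesis .
qed

end
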